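(* Let $C$ be an $n\times m$ pairing matrix, $\mathsf{A}_C$ the associated automaton with set of states $S=\{a_1,\ldots,a_n\}$ and alphabet $X=\{b_1,\ldots,b_m\}$, and let $k\ge 1$. Let $s,t\in S$ and $x,y\in X$. (i) If there is an arrow $s\xrightarrow{x^k|y^k}s$ in $\mathsf{A}_C^{*}$, where $x^k=xx\ldots x$ and $y^k=yy\ldots y$ are words of length $k$, then $(yx^{-1})^k=e$ in $\Gamma_C$. (ii) If there is an arrow $s^k\xrightarrow{x|x}t^k$ in $\mathsf{A}_C^{*}$, where $s^k=ss\ldots s$ and $t^k=tt\ldots t$ are words of length $k$, then $(t^{-1}s)^k=e$ in $\Gamma_C$.
   Context: A pairing matrix is an $n\times m$ matrix $C=(c_{ij})$ with $nm$ even and entries $c_{ij}\in\{1,2,\ldots,nm/2\}$ such that no row or column contains a repeated value, and for every pair of indices $(i,j)$ there exists exactly one pair $(i',j')\neq(i,j)$ with $c_{ij}=c_{i'j'}$. The associated group is $$\Gamma_C=\langle a_1,\ldots,a_n,b_1,\ldots,b_m \mid a_ib_j=a_{i'}b_{j'} \text{ whenever } c_{ij}=c_{i'j'}\rangle,$$ with identity $e$; states $a_i$ and letters $b_j$ below are also viewed as elements of $\Gamma_C$. A Mealy automaton over an alphabet $X$ is a quadruple $\mathsf{A}=(S,X,\mu,\nu)$, where $S$ is the set of states, $\mu:S\times X\to S$ is the transition map and $\nu:S\times X\to X$ is the output map. It is identified with the directed labeled graph with vertex set $S$ and an arrow $s\xrightarrow{x|\nu(s,x)}\mu(s,x)$ for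 every $s\in S$, $x\in X$. The automaton $\mathsf{A}_C$ associated to a pairing matrix $C$ has states $S=\{a_1,\ldots,a_n\}$, alphabet $X=\{b_1,\ldots,b_m\}$ and arrows $a_i\xrightarrow{b_j|b_{j'}}a_{i'}$ whenever $(i,j)\ne(i',j')$ and $c_{ij}=c_{i'j'}$. An automaton $\mathsf{A}=(S,X,\mu,\nu)$ extends uniquely to an automaton $\mathsf{A}^{*}$ whose states and letters are the words over $S$ and $X$ respectively, by the rules (applied to words): $$s\xrightarrow{x_1|y_1}q \text{ and } q\xrightarrow{x_2|y_2}t \ \Rightarrow\ s\xrightarrow{x_1x_2|y_1y_2}t,$$ $$s_1\xrightarrow{x|z}t_1 \text{ and } s_2\xrightarrow{z|y}t_2 \ \Rightarrow\ s_1s_2\xrightarrow{x|y}t_1t_2.$$ *)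

theory Defs
  imports "Jordan_Normal_Form.Matrix" "HOL-Algebra.Group"
begin

section \<open>Group presentations\<close>

type_synonym 'g word = "('g \<times> bool) list"

text \<open>The pair \<open>(g, True)\<close> stands for the generator \<open>g\<close> and \<open>(g, False)\<close> for its formal inverse.
  A set of relations is a set of pairs \<open>(u, v)\<close> of words, read as the equation \<open>u = v\<close>.\<close>

abbreviation words :: "'g set \<Rightarrow> 'g word set" where
  "words X \<equiv> lists (X \<times> UNIV)"

inductive_set word_cong :: "'g set \<Rightarrow> 'g word rel \<Rightarrow> 'g word rel"
  for X :: "'g set" and R :: "'g word rel" where
  refl: "u \<in> words X \<Longrightarrow> (u, u) \<in> word_cong X R"
| sym: "(u, v) \<in> word_cong X R \<Longrightarrow> (v, u) \<in> word_cong X R"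
| trans: "(u, v) \<in> word_cong X R \<Longrightarrow> (v, w) \<in> word_cong X R \<Longrightarrow> (u, w) \<in> word_cong X R"
| append: "(u, v) \<in> word_cong X R \<Longrightarrow> (u', v') \<in> word_cong X R
    \<Longrightarrow> (u @ u', v @ v') \<in> word_cong X R"
| cancel: "g \<in> X \<Longrightarrow> ([(g, b), (g, \<not> b)], []) \<in> word_cong X R"
| rel: "(u, v) \<in> R \<Longrightarrow> u \<in> words X \<Longrightarrow> v \<in> words X \<Longrightarrow> (u, v) \<in> word_cong X R"

definition presented_group :: "'g set \<Rightarrow> 'g word rel \<Rightarrow> 'g word set monoid" where
  "presented_group X R =
    \<lparr>carrier = words X // word_cong X R,
     mult = (\<lambda>A B. \<Union>u\<in>A. \<Union>v\<in>B. word_cong X R `` {u @ v}),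
     one = word_cong X R `` {[]}\<rparr>"

definition generator :: "'g set \<Rightarrow> 'g word rel \<Rightarrow> 'g \<Rightarrow> 'g word set" where
  "generator X R g = word_cong X R `` {[(g, True)]}"

lemma word_cong_in_words:
  "(u, v) \<in> word_cong X R \<Longrightarrow> u \<in> words X \<and> v \<in> words X"
  by (induction rule: word_cong.induct) auto

lemma equiv_word_cong: "equiv (words X) (word_cong X R)"
proof (rule equivI)
  show "word_cong X R \<subseteq> words X \<times> words X"
    using word_cong_in_words by fastforce
  show "refl_on (words X) (word_cong X R)"
    by (rule refl_onI) (rule word_cong.refl)
  show "Relation.sym (word_cong X R)"
    by (rule symI) (rule word_cong.sym)
  show "Relation.trans (word_cong X R)"
    by (rule transI) (rule word_cong.trans)
qed

lemma word_cong_class_eq: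
  "u \<in> words X \<Longrightarrow> v \<in> words X \<Longrightarrow>
    word_cong X R `` {u} = word_cong X R `` {v} \<longleftrightarrow> (u, v) \<in> word_cong X R"
  using eq_equiv_class_iff[OF equiv_word_cong] by metis

lemma presented_group_mult:
  assumes "u \<in> words X" "v \<in> words X"
  shows "word_cong X R `` {u} \<otimes>\<^bsub>presented_group X R\<^esub> word_cong X R `` {v}
    = word_cong X R `` {u @ v}"
proof -
  have "congruent2 (word_cong X R) (word_cong X R) (\<lambda>u v. word_cong X R `` {u @ v})"
    by (rule congruent2I[OF equiv_word_cong equiv_word_cong])
      (metis equiv_class_eq equiv_word_cong word_cong.append word_cong.refl)+
  from UN_equiv_class2[OF equiv_word_cong equiv_word_cong this assms] show ?thesis
    by (simp add: presented_group_def)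
qed

definition word_inverse :: "'g word \<Rightarrow> 'g word" where
  "word_inverse w = rev (map (\<lambda>(g, b). (g, \<not> b)) w)"

lemma word_inverse_in_words: "w \<in> words X \<Longrightarrow> word_inverse w \<in> words X"
  by (auto simp: word_inverse_def)

lemma word_inverse_cancel:
  "w \<in> words X \<Longrightarrow> (word_inverse w @ w, []) \<in> word_cong X R"
proof (induction w rule: list.induct)
  case Nil
  then show ?case by (simp add: word_inverse_def word_cong.refl)
next
  case (Cons p w)
  obtain g b where p: "p = (g, b)" by (cases p)
  have g: "g \<in> X" and w: "w \<in> words X" using Cons.prems p by auto
  have "([(g, \<not> b), (g, b)], []) \<in> word_cong X R"
    using word_cong.cancel[OF g, of "\<not> b"] by simp
  then have "([(g, \<not> b), (g, b)] @ w, [] @ w) \<in> word_cong X R"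
    using word_cong.append word_cong.refl w by blast
  then have "(word_inverse w @ ([(g, \<not> b), (g, b)] @ w), word_inverse w @ ([] @ w))
      \<in> word_cong X R"
    using word_cong.append word_cong.refl word_inverse_in_words w by blast
  moreover have "(word_inverse w @ ([] @ w), []) \<in> word_cong X R"
    using Cons.IH w by simp
  ultimately have "(word_inverse w @ ([(g, \<not> b), (g, b)] @ w), []) \<in> word_cong X R"
    by (rule word_cong.trans)
  then show ?case by (simp add: word_inverse_def p)
qed

lemma presented_group_carrierE:
  assumes "A \<in> carrier (presented_group X R)"
  obtains u where "u \<in> words X" "A = word_cong X R `` {u}"
proof -
  have "A \<in> words X // word_cong X R" using assms by (simp add: presented_group_def)
  then show thesis by (elim quotientE) (rule that)
qed

lemma group_presented_group: "group (presented_group X R)"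
proof (rule groupI)
  let ?G = "presented_group X R" and ?c = "\<lambda>u. word_cong X R `` {u}"
  have carrier: "carrier ?G = ?c ` words X"
    by (auto simp: presented_group_def quotient_def)
  have one: "\<one>\<^bsub>?G\<^esub> = ?c []" by (simp add: presented_group_def)
  show "\<one>\<^bsub>?G\<^esub> \<in> carrier ?G" unfolding one carrier by (intro imageI) simp
  show "A \<otimes>\<^bsub>?G\<^esub> B \<in> carrier ?G" if A: "A \<in> carrier ?G" "B \<in> carrier ?G" for A B
  proof -
    obtain u v where "u \<in> words X" "A = ?c u" "v \<in> words X" "B = ?c v"
      using A by (metis presented_group_carrierE)
    then show ?thesis unfolding carrier
      by (simp add: presented_group_mult)
  qed
  show "A \<otimes>\<^bsub>?G\<^esub> B \<otimes>\<^bsub>?G\<^esub> D = A \<otimes>\<^bsub>?G\<^esub> (B \<otimes>\<^bsub>?G\<^esub> D)"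
    if A: "A \<in> carrier ?G" "B \<in> carrier ?G" "D \<in> carrier ?G" for A B D
  proof -
    obtain u v w where "u \<in> words X" "A = ?c u" "v \<in> words X" "B = ?c v" "w \<in> words X" "D = ?c w"
      using A by (metis presented_group_carrierE)
    then show ?thesis by (simp add: presented_group_mult)
  qed
  show "\<one>\<^bsub>?G\<^esub> \<otimes>\<^bsub>?G\<^esub> A = A" if A: "A \<in> carrier ?G" for A
  proof -
    obtain u where "u \<in> words X" "A = ?c u" using A by (metis presented_group_carrierE)
    then show ?thesis by (simp add: one presented_group_mult)
  qed
  show "\<exists>B\<in>carrier ?G. B \<otimes>\<^bsub>?G\<^esub> A = \<one>\<^bsub>?G\<^esub>" if A: "A \<in> carrier ?G" for A
  proof -
    obtain u where u: "u \<in> words X" "A = ?c u" using A by (metis presented_group_carrierE)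
    have u': "word_inverse u \<in> words X" by (rule word_inverse_in_words[OF u(1)])
    have "?c (word_inverse u @ u) = ?c []"
      by (rule equiv_class_eq[OF equiv_word_cong word_inverse_cancel[OF u(1)]])
    then have "?c (word_inverse u) \<otimes>\<^bsub>?G\<^esub> A = \<one>\<^bsub>?G\<^esub>"
      unfolding u(2) one presented_group_mult[OF u' u(1)] .
    moreover have "?c (word_inverse u) \<in> carrier ?G"
      unfolding carrier using u' by (rule imageI)
    ultimately show ?thesis by blast
  qed
qed

lemma generator_in_carrier:
  "g \<in> X \<Longrightarrow> generator X R g \<in> carrier (presented_group X R)"
  unfolding generator_def presented_group_def by (simp add: quotientI)

text \<open>Von Dyck: a map of the generators into a group respecting the relations extends to a
  homomorphism.\<close>

definition eval_word :: "('h, 'r) monoid_scheme \<Rightarrow> ('g \<Rightarrow> 'h) \<Rightarrow> 'g word \<Rightarrow> 'h" where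
  "eval_word H f w =
    foldr (\<lambda>(g, b) h. (if b then f g else inv\<^bsub>H\<^esub> f g) \<otimes>\<^bsub>H\<^esub> h) w \<one>\<^bsub>H\<^esub>"

lemma eval_word_closed:
  assumes "group H" "f \<in> X \<rightarrow> carrier H" "w \<in> words X"
  shows "eval_word H f w \<in> carrier H"
proof -
  interpret group H by fact
  show ?thesis using assms(3)
  proof (induction w rule: list.induct)
    case (Cons p w)
    obtain g b where "p = (g, b)" by (cases p)
    with Cons assms(2) show ?case by (auto simp: eval_word_def Pi_iff)
  qed (simp add: eval_word_def)
qed

lemma eval_word_append:
  assumes "group H" "f \<in> X \<rightarrow> carrier H" "u \<in> words X" "v \<in> words X"
  shows "eval_word H f (u @ v) = eval_word H f u \<otimes>\<^bsub>H\<^esub> eval_word H f v"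
proof -
  interpret group H by fact
  have v: "eval_word H f v \<in> carrier H" using eval_word_closed assms by blast
  show ?thesis using assms(3)
  proof (induction u rule: list.induct)
    case Nil
    then show ?case using v by (simp add: eval_word_def)
  next
    case (Cons p u)
    obtain g b where p: "p = (g, b)" by (cases p)
    have u: "u \<in> words X" and g: "f g \<in> carrier H"
      using Cons.prems p assms(2) by (auto simp: Pi_iff)
    have "eval_word H f u \<in> carrier H" using eval_word_closed assms(1,2) u by blast
    with Cons.IH[OF u] g v show ?case by (simp add: p eval_word_def m_assoc)
  qed
qed

lemma eval_word_cong:
  assumes "group H" "f \<in> X \<rightarrow> carrier H"
    and "\<And>u v. (u, v) \<in> R \<Longrightarrow> eval_word H f u = eval_word H f v"
    and "(u, v) \<in> word_cong X R"
  shows "eval_word H f u = eval_word H f v"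
  using assms(4)
proof (induction rule: word_cong.induct)
  case (append u v u' v')
  then show ?case
    using eval_word_append[OF assms(1,2)] word_cong_in_words by metis
next
  case (cancel g b)
  interpret group H by fact
  have "f g \<in> carrier H" using cancel assms(2) by auto
  then show ?case by (cases b) (simp_all add: eval_word_def)
qed (use assms(3) in auto)

lemma presented_group_universal:
  assumes H: "group H" and f: "f \<in> X \<rightarrow> carrier H"
    and R: "\<And>u v. (u, v) \<in> R \<Longrightarrow> eval_word H f u = eval_word H f v"
  shows "\<exists>h \<in> hom (presented_group X R) H. \<forall>g\<in>X. h (generator X R g) = f g"
proof -
  interpret group H by fact
  let ?G = "presented_group X R" and ?c = "\<lambda>u. word_cong X R `` {u}"
  define h where "h A = the_elem (eval_word H f ` A)" for A
  have h: "h (?c u) = eval_word H f u" if u: "u \<in> words X" for u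
  proof -
    have "eval_word H f ` ?c u = {eval_word H f u}"
      using eval_word_cong[OF H f R] word_cong.refl[OF u] by auto
    then show ?thesis by (simp add: h_def)
  qed
  have carrier: "carrier ?G = ?c ` words X"
    by (auto simp: presented_group_def quotient_def)
  have "h \<in> hom ?G H"
  proof (rule homI)
    show "h A \<in> carrier H" if A: "A \<in> carrier ?G" for A
    proof -
      obtain u where "u \<in> words X" "A = ?c u" using A by (metis presented_group_carrierE)
      then show ?thesis using h eval_word_closed[OF H f] by metis
    qed
    show "h (A \<otimes>\<^bsub>?G\<^esub> B) = h A \<otimes>\<^bsub>H\<^esub> h B" if A: "A \<in> carrier ?G" "B \<in> carrier ?G" for A B
    proof -
      obtain u v where uv: "u \<in> words X" "A = ?c u" "v \<in> words X" "B = ?c v"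
        using A by (metis presented_group_carrierE)
      then have "u @ v \<in> words X" by simp
      with uv show ?thesis
        using h eval_word_append[OF H f] presented_group_mult by metis
    qed
  qed
  moreover have "\<forall>g\<in>X. h (generator X R g) = f g"
    using f by (auto simp: generator_def h eval_word_def Pi_iff)
  ultimately show ?thesis by blast
qed


section \<open>Mealy automata\<close>

record ('s, 'x) automaton =
  states :: "'s set"
  alphabet :: "'x set"
  next_state :: "'s \<Rightarrow> 'x \<Rightarrow> 's"
  output_letter :: "'s \<Rightarrow> 'x \<Rightarrow> 'x"

definition mealy :: "('s, 'x) automaton \<Rightarrow> bool" where
  "mealy A \<longleftrightarrow> (\<forall>s\<in>states A. \<forall>x\<in>alphabet A.
     next_state A s x \<in> states A \<and> output_letter A s x \<in> alphabet A)"

text \<open>\<open>arrow A s x y t\<close> is the arrow from \<open>s\<close> to \<open>t\<close> labelled \<open>x|y\<close>.\<close>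

definition arrow :: "('s, 'x) automaton \<Rightarrow> 's \<Rightarrow> 'x \<Rightarrow> 'x \<Rightarrow> 's \<Rightarrow> bool" where
  "arrow A s x y t \<longleftrightarrow>
     s \<in> states A \<and> x \<in> alphabet A \<and> output_letter A s x = y \<and> next_state A s x = t"

fun run :: "('s, 'x) automaton \<Rightarrow> 's \<Rightarrow> 'x list \<Rightarrow> 's" where
  "run A s [] = s"
| "run A s (x # xs) = run A (next_state A s x) xs"

fun run_output :: "('s, 'x) automaton \<Rightarrow> 's \<Rightarrow> 'x list \<Rightarrow> 'x list" where
  "run_output A s [] = []"
| "run_output A s (x # xs) = output_letter A s x # run_output A (next_state A s x) xs"

text \<open>In a word of states the leftmost state reads the input first and passes its output on to
  the right.\<close>

fun star_next :: "('s, 'x) automaton \<Rightarrow> 's list \<Rightarrow> 'x list \<Rightarrow> 's list" where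
  "star_next A [] xs = []"
| "star_next A (s # ss) xs = run A s xs # star_next A ss (run_output A s xs)"

fun star_output :: "('s, 'x) automaton \<Rightarrow> 's list \<Rightarrow> 'x list \<Rightarrow> 'x list" where
  "star_output A [] xs = xs"
| "star_output A (s # ss) xs = star_output A ss (run_output A s xs)"

text \<open>The lemmas \<open>mealy_star\<close> to \<open>star_unique\<close> below show that this is the unique extension of
  \<open>A\<close> to words closed under the two composition rules.  The rules do not determine the arrows at
  empty words, which are here made to act trivially.\<close>

definition star :: "('s, 'x) automaton \<Rightarrow> ('s list, 'x list) automaton" where
  "star A = \<lparr>states = lists (states A), alphabet = lists (alphabet A),
     next_state = star_next A, output_letter = star_output A\<rparr>"

lemma star_simps [simp]:
  "states (star A) = lists (states A)"
  "alphabet (star A) = lists (alphabet A)"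
  "next_state (star A) = star_next A"
  "output_letter (star A) = star_output A"
  by (simp_all add: star_def)

lemma run_closed:
  assumes "mealy A"
  shows "s \<in> states A \<Longrightarrow> xs \<in> lists (alphabet A) \<Longrightarrow>
    run A s xs \<in> states A \<and> run_output A s xs \<in> lists (alphabet A)"
  using assms by (induction xs arbitrary: s) (auto simp: mealy_def)

lemma mealy_star: "mealy A \<Longrightarrow> mealy (star A)"
proof -
  assume A: "mealy A"
  have "star_next A ss xs \<in> lists (states A) \<and> star_output A ss xs \<in> lists (alphabet A)"
    if "ss \<in> lists (states A)" "xs \<in> lists (alphabet A)" for ss xs
    using that by (induction ss arbitrary: xs) (auto simp: run_closed[OF A])
  then show ?thesis by (simp add: mealy_def)
qed

lemma star_extends: "arrow A s x y t \<Longrightarrow> arrow (star A) [s] [x] [y] [t]"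
  by (simp add: arrow_def)

lemma run_append: "run A s (x @ x') = run A (run A s x) x'"
  by (induction x arbitrary: s) auto

lemma run_output_append:
  "run_output A s (x @ x') = run_output A s x @ run_output A (run A s x) x'"
  by (induction x arbitrary: s) auto

lemma star_input_rule:
  assumes "arrow (star A) s x y q" "arrow (star A) q x' y' t"
  shows "arrow (star A) s (x @ x') (y @ y') t"
proof -
  have "star_next A s (x @ x') = star_next A (star_next A s x) x' \<and>
      star_output A s (x @ x') = star_output A s x @ star_output A (star_next A s x) x'"
    by (induction s arbitrary: x x') (auto simp: run_append run_output_append)
  then show ?thesis using assms by (auto simp: arrow_def)
qed

lemma star_state_rule:
  assumes "arrow (star A) s x z t" "arrow (star A) s' z y t'"
  shows "arrow (star A) (s @ s') x y (t @ t')"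
proof -
  have "star_next A (s @ s') x = star_next A s x @ star_next A s' (star_output A s x) \<and>
      star_output A (s @ s') x = star_output A s' (star_output A s x)"
    by (induction s arbitrary: x) auto
  then show ?thesis using assms by (auto simp: arrow_def)
qed

lemma star_unique:
  assumes A: "mealy A"
    and extends: "\<And>s x y t. arrow A s x y t \<Longrightarrow> arrow B [s] [x] [y] [t]"
    and input_rule: "\<And>s x y q x' y' t. arrow B s x y q \<Longrightarrow> arrow B q x' y' t
      \<Longrightarrow> arrow B s (x @ x') (y @ y') t"
    and state_rule: "\<And>s x z t s' y t'. arrow B s x z t \<Longrightarrow> arrow B s' z y t'
      \<Longrightarrow> arrow B (s @ s') x y (t @ t')"
    and s: "s \<in> lists (states A)" "s \<noteq> []" and x: "x \<in> lists (alphabet A)" "x \<noteq> []"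
  shows "arrow B s x y t \<longleftrightarrow> arrow (star A) s x y t"
proof -
  have single: "arrow B [s] x (run_output A s x) [run A s x]"
    if "s \<in> states A" "x \<in> lists (alphabet A)" "x \<noteq> []" for s x
    using that
  proof (induction x arbitrary: s rule: list.induct)
    case (Cons a x)
    have a: "arrow B [s] [a] [output_letter A s a] [next_state A s a]"
      using Cons.prems by (intro extends) (simp add: arrow_def)
    show ?case
    proof (cases "x = []")
      case True
      then show ?thesis using a by simp
    next
      case False
      then have "arrow B [next_state A s a] x (run_output A (next_state A s a) x)
          [run A (next_state A s a) x]"
        using Cons A by (auto simp: mealy_def)
      from input_rule[OF a this] show ?thesis by simp
    qed
  qed simp
  have nonempty: "run_output A s x \<noteq> []" if "x \<noteq> []" for s x
    using that by (cases x) auto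
  have "arrow B s x (star_output A s x) (star_next A s x)"
    using s x
  proof (induction s arbitrary: x rule: list.induct)
    case (Cons q s)
    have q: "arrow B [q] x (run_output A q x) [run A q x]"
      using Cons.prems by (intro single) auto
    show ?case
    proof (cases "s = []")
      case True
      then show ?thesis using q by simp
    next
      case False
      have "run_output A q x \<in> lists (alphabet A)"
        using run_closed[OF A] Cons.prems by simp
      then have "arrow B s (run_output A q x) (star_output A s (run_output A q x))
          (star_next A s (run_output A q x))"
        using Cons False nonempty by simp
      from state_rule[OF q this] show ?thesis by simp
    qed
  qed simp
  then show ?thesis using s x by (auto simp: arrow_def)
qed


section \<open>Pairing matrices\<close>

text \<open>Rows and columns are numbered from \<open>0\<close>, as usual for \<^typ>\<open>'a mat\<close>.\<close>

definition pairing_matrix :: "nat mat \<Rightarrow> bool" where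
  "pairing_matrix C \<longleftrightarrow>
     even (dim_row C * dim_col C) \<and>
     (\<forall>i<dim_row C. \<forall>j<dim_col C. C $$ (i, j) \<in> {1..dim_row C * dim_col C div 2}) \<and>
     (\<forall>i<dim_row C. inj_on (\<lambda>j. C $$ (i, j)) {..<dim_col C}) \<and>
     (\<forall>j<dim_col C. inj_on (\<lambda>i. C $$ (i, j)) {..<dim_row C}) \<and>
     (\<forall>i<dim_row C. \<forall>j<dim_col C.
        \<exists>!p. p \<in> {..<dim_row C} \<times> {..<dim_col C} \<and> p \<noteq> (i, j) \<and> C $$ (i, j) = C $$ p)"

definition partner :: "nat mat \<Rightarrow> nat \<Rightarrow> nat \<Rightarrow> nat \<times> nat" where
  "partner C i j =
     (THE p. p \<in> {..<dim_row C} \<times> {..<dim_col C} \<and> p \<noteq> (i, j) \<and> C $$ (i, j) = C $$ p)"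

text \<open>State \<open>i\<close> is the \<open>i\<close>-th \<open>a\<close>, letter \<open>j\<close> is the \<open>j\<close>-th \<open>b\<close>.\<close>

definition pairing_automaton :: "nat mat \<Rightarrow> (nat, nat) automaton" where
  "pairing_automaton C = \<lparr>states = {..<dim_row C}, alphabet = {..<dim_col C},
     next_state = (\<lambda>i j. fst (partner C i j)), output_letter = (\<lambda>i j. snd (partner C i j))\<rparr>"

lemma partner_props:
  assumes "pairing_matrix C" "i < dim_row C" "j < dim_col C"
  shows "partner C i j \<in> {..<dim_row C} \<times> {..<dim_col C} \<and> partner C i j \<noteq> (i, j) \<and>
    C $$ (i, j) = C $$ partner C i j"
  unfolding partner_def by (rule theI') (use assms in \<open>simp add: pairing_matrix_def\<close>)

lemma mealy_pairing_automaton: "pairing_matrix C \<Longrightarrow> mealy (pairing_automaton C)"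
  using partner_props by (fastforce simp: mealy_def pairing_automaton_def mem_Times_iff)

lemma arrow_pairing_automaton_iff:
  assumes C: "pairing_matrix C"
  shows "arrow (pairing_automaton C) i j j' i' \<longleftrightarrow>
    i < dim_row C \<and> j < dim_col C \<and> i' < dim_row C \<and> j' < dim_col C \<and>
    (i, j) \<noteq> (i', j') \<and> C $$ (i, j) = C $$ (i', j')"
proof (cases "i < dim_row C \<and> j < dim_col C")
  case True
  then have "\<exists>!p. p \<in> {..<dim_row C} \<times> {..<dim_col C} \<and> p \<noteq> (i, j) \<and> C $$ (i, j) = C $$ p"
    using C by (simp add: pairing_matrix_def)
  then have "partner C i j = p \<longleftrightarrow>
      p \<in> {..<dim_row C} \<times> {..<dim_col C} \<and> p \<noteq> (i, j) \<and> C $$ (i, j) = C $$ p" for p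
    using partner_props[OF C] True by blast
  from this[of "(i', j')"] show ?thesis
    using True by (auto simp: arrow_def pairing_automaton_def prod_eq_iff)
qed (auto simp: arrow_def pairing_automaton_def)

text \<open>Generators of the pairing group: \<open>Inl i\<close> for the states, \<open>Inr j\<close> for the letters.\<close>

definition pairing_generators :: "nat mat \<Rightarrow> (nat + nat) set" where
  "pairing_generators C = {..<dim_row C} <+> {..<dim_col C}"

definition pairing_relations :: "nat mat \<Rightarrow> (nat + nat) word rel" where
  "pairing_relations C =
     {([(Inl i, True), (Inr j, True)], [(Inl i', True), (Inr j', True)]) | i j i' j'.
        i < dim_row C \<and> j < dim_col C \<and> i' < dim_row C \<and> j' < dim_col C \<and>
        C $$ (i, j) = C $$ (i', j')}"

definition pairing_group :: "nat mat \<Rightarrow> (nat + nat) word set monoid" where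
  "pairing_group C = presented_group (pairing_generators C) (pairing_relations C)"

definition state_elem :: "nat mat \<Rightarrow> nat \<Rightarrow> (nat + nat) word set" where
  "state_elem C i = generator (pairing_generators C) (pairing_relations C) (Inl i)"

definition letter_elem :: "nat mat \<Rightarrow> nat \<Rightarrow> (nat + nat) word set" where
  "letter_elem C j = generator (pairing_generators C) (pairing_relations C) (Inr j)"

lemma group_pairing_group: "group (pairing_group C)"
  unfolding pairing_group_def by (rule group_presented_group)

lemma state_elem_in_carrier:
  "i < dim_row C \<Longrightarrow> state_elem C i \<in> carrier (pairing_group C)"
  unfolding pairing_group_def state_elem_def
  by (rule generator_in_carrier) (auto simp: pairing_generators_def)

lemma letter_elem_in_carrier:
  "j < dim_col C \<Longrightarrow> letter_elem C j \<in> carrier (pairing_group C)"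
  unfolding pairing_group_def letter_elem_def
  by (rule generator_in_carrier) (auto simp: pairing_generators_def)

end

theory Submission
  imports Defs
begin

text \<open>In the pairing group an arrow \<open>a \<rightarrow> a'\<close> labelled \<open>b|b'\<close> reads both as \<open>a' = a (b b'\<^sup>-\<^sup>1)\<close> and
  as \<open>b' = (a'\<^sup>-\<^sup>1 a) b\<close>.  If a state \<open>s\<close> reads \<open>x\<^sup>k\<close> and writes \<open>y\<^sup>k\<close>, every step multiplies the
  current state on the right by \<open>x y\<^sup>-\<^sup>1\<close>, so returning to \<open>s\<close> forces \<open>(x y\<^sup>-\<^sup>1)\<^sup>k = e\<close>.  Dually, if \<open>x\<close>
  passes through \<open>s\<^sup>k\<close> and turns it into \<open>t\<^sup>k\<close>, every step multiplies the current letter on the left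
  by \<open>t\<^sup>-\<^sup>1 s\<close>.\<close>

text \<open>A product of two generator classes is the class of a two-letter word, so a defining
  relation between such words becomes an equation between products.\<close>

lemma pairing_group_relation:
  assumes "i < dim_row C" "j < dim_col C" "i' < dim_row C" "j' < dim_col C"
    and "C $$ (i, j) = C $$ (i', j')"
  shows "state_elem C i \<otimes>\<^bsub>pairing_group C\<^esub> letter_elem C j =
    state_elem C i' \<otimes>\<^bsub>pairing_group C\<^esub> letter_elem C j'"
proof -
  let ?X = "pairing_generators C" and ?R = "pairing_relations C"
  have mult: "state_elem C p \<otimes>\<^bsub>pairing_group C\<^esub> letter_elem C q =
      word_cong ?X ?R `` {[(Inl p, True), (Inr q, True)]}"
    \<comment> \<open>Kept beside \<open>mult\<close> because \<open>word_cong.rel\<close> accepts a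
      relation only between words over the generators.\<close>
    and word: "[(Inl p, True), (Inr q, True)] \<in> words ?X"
    if "p < dim_row C" "q < dim_col C" for p q
  proof -
    have "[(Inl p, True)] \<in> words ?X" "[(Inr q, True)] \<in> words ?X"
      using that by (auto simp: pairing_generators_def)
    from presented_group_mult[OF this, of ?R]
    show "state_elem C p \<otimes>\<^bsub>pairing_group C\<^esub> letter_elem C q =
        word_cong ?X ?R `` {[(Inl p, True), (Inr q, True)]}"
      by (simp add: state_elem_def letter_elem_def generator_def pairing_group_def)
    show "[(Inl p, True), (Inr q, True)] \<in> words ?X"
      using that by (auto simp: pairing_generators_def)
  qed
  have "([(Inl i, True), (Inr j, True)], [(Inl i', True), (Inr j', True)]) \<in> ?R"
    using assms by (auto simp: pairing_relations_def)
  then have "([(Inl i, True), (Inr j, True)], [(Inl i', True), (Inr j', True)])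
      \<in> word_cong ?X ?R"
    using assms by (intro word_cong.rel word)
  from equiv_class_eq[OF equiv_word_cong this] show ?thesis
    using assms by (simp add: mult)
qed

text \<open>The bridge from automaton to group: an arrow joins two equal entries of the matrix,
  hence yields a relation. The two bounds let an induction continue from the new state or
  letter.\<close>

lemma pairing_automaton_step:
  assumes C: "pairing_matrix C" and i: "i < dim_row C" and j: "j < dim_col C"
    and i': "i' = next_state (pairing_automaton C) i j"
    and j': "j' = output_letter (pairing_automaton C) i j"
  shows "i' < dim_row C" "j' < dim_col C"
    and "state_elem C i \<otimes>\<^bsub>pairing_group C\<^esub> letter_elem C j =
      state_elem C i' \<otimes>\<^bsub>pairing_group C\<^esub> letter_elem C j'"
proof -
  have "arrow (pairing_automaton C) i j j' i'"
    using i j by (simp add: arrow_def pairing_automaton_def i' j')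
  then have *: "i' < dim_row C" "j' < dim_col C" "C $$ (i, j) = C $$ (i', j')"
    by (simp_all add: arrow_pairing_automaton_iff[OF C])
  then show "i' < dim_row C" "j' < dim_col C" by simp_all
  show "state_elem C i \<otimes>\<^bsub>pairing_group C\<^esub> letter_elem C j =
      state_elem C i' \<otimes>\<^bsub>pairing_group C\<^esub> letter_elem C j'"
    by (rule pairing_group_relation[OF i j *])
qed

text \<open>Since every output letter is \<open>y\<close>, each step contributes the same factor.
  The start state varies in the induction, and the end state is left free, because intermediate
  states need not return to \<open>s\<close>.\<close>

lemma state_elem_run_replicate:
  assumes C: "pairing_matrix C" and x: "x < dim_col C" and y: "y < dim_col C"
    and "s < dim_row C"
    and "run_output (pairing_automaton C) s (replicate k x) = replicate k y"
  shows "state_elem C (run (pairing_automaton C) s (replicate k x)) =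
    state_elem C s \<otimes>\<^bsub>pairing_group C\<^esub>
      (letter_elem C x \<otimes>\<^bsub>pairing_group C\<^esub> inv\<^bsub>pairing_group C\<^esub> letter_elem C y)
        [^]\<^bsub>pairing_group C\<^esub> k"
proof -
  interpret group "pairing_group C" by (rule group_pairing_group)
  note carrier = state_elem_in_carrier letter_elem_in_carrier
  show ?thesis using assms(4,5)
  proof (induction k arbitrary: s)
    case 0
    then show ?case by (simp add: carrier)
  next
    case (Suc k)
    let ?q = "next_state (pairing_automaton C) s x"
    let ?g = "letter_elem C x \<otimes>\<^bsub>pairing_group C\<^esub> inv\<^bsub>pairing_group C\<^esub> letter_elem C y"
    have out: "y = output_letter (pairing_automaton C) s x"
      using Suc.prems by simp
    note step = pairing_automaton_step[OF C Suc.prems(1) x HOL.refl out]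
    have "state_elem C ?q = state_elem C s \<otimes>\<^bsub>pairing_group C\<^esub>
        letter_elem C x \<otimes>\<^bsub>pairing_group C\<^esub> inv\<^bsub>pairing_group C\<^esub> letter_elem C y"
      using step Suc.prems(1) x y by (simp add: carrier inv_solve_right)
    \<comment> \<open>The first step puts its factor in front of the \<open>k\<close> later ones,
      while the power with exponent \<open>Suc k\<close> unfolds with the extra factor at the
      end.\<close>
    moreover have "?g [^]\<^bsub>pairing_group C\<^esub> k \<otimes>\<^bsub>pairing_group C\<^esub> ?g =
        ?g \<otimes>\<^bsub>pairing_group C\<^esub> ?g [^]\<^bsub>pairing_group C\<^esub> k"
      using nat_pow_Suc2[of ?g k] x y by (simp add: carrier)
    ultimately show ?case
      using Suc.IH[OF step(1)] Suc.prems x y by (simp add: carrier m_assoc)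
  qed
qed

text \<open>The dual induction, on the number of states: the letter passed on changes from state to
  state, so \<open>x\<close> varies while the final letter \<open>z\<close> stays fixed.\<close>

lemma letter_elem_star_output_replicate:
  assumes C: "pairing_matrix C" and s: "s < dim_row C" and t: "t < dim_row C"
    and "x < dim_col C"
    and "star_next (pairing_automaton C) (replicate k s) [x] = replicate k t"
    and "star_output (pairing_automaton C) (replicate k s) [x] = [z]"
  shows "letter_elem C z =
    (inv\<^bsub>pairing_group C\<^esub> state_elem C t \<otimes>\<^bsub>pairing_group C\<^esub> state_elem C s)
      [^]\<^bsub>pairing_group C\<^esub> k \<otimes>\<^bsub>pairing_group C\<^esub> letter_elem C x"
proof -
  interpret group "pairing_group C" by (rule group_pairing_group)
  note carrier = state_elem_in_carrier letter_elem_in_carrier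
  show ?thesis using assms(4-6)
  proof (induction k arbitrary: x)
    case 0
    then show ?case by (simp add: carrier)
  next
    case (Suc k)
    let ?w = "output_letter (pairing_automaton C) s x"
    have nxt: "t = next_state (pairing_automaton C) s x"
      using Suc.prems by simp
    \<comment> \<open>Here the next state is prescribed as \<open>t\<close> and the output letter is
      free, the reverse of the previous induction.\<close>
    note step = pairing_automaton_step[OF C s Suc.prems(1) nxt HOL.refl]
    have "letter_elem C ?w = inv\<^bsub>pairing_group C\<^esub> state_elem C t \<otimes>\<^bsub>pairing_group C\<^esub>
        (state_elem C s \<otimes>\<^bsub>pairing_group C\<^esub> letter_elem C x)"
      using step Suc.prems(1) s t by (simp add: carrier inv_solve_left)
    then show ?case
      using Suc.IH[OF step(2)] Suc.prems s t by (simp add: carrier m_assoc)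
  qed
qed

theorem proposition3:
  fixes C :: "nat mat" and n m k s t x y :: nat
  assumes "C \<in> carrier_mat n m" and "pairing_matrix C" and "k \<ge> 1"
    and "s \<in> states (pairing_automaton C)" and "t \<in> states (pairing_automaton C)"
    and "x \<in> alphabet (pairing_automaton C)" and "y \<in> alphabet (pairing_automaton C)"
  shows "(arrow (star (pairing_automaton C)) [s] (replicate k x) (replicate k y) [s] \<longrightarrow>
       (letter_elem C y \<otimes>\<^bsub>pairing_group C\<^esub> inv\<^bsub>pairing_group C\<^esub> letter_elem C x)
         [^]\<^bsub>pairing_group C\<^esub> k = \<one>\<^bsub>pairing_group C\<^esub>) \<and>
     (arrow (star (pairing_automaton C)) (replicate k s) [x] [x] (replicate k t) \<longrightarrow>
       (inv\<^bsub>pairing_group C\<^esub> state_elem C t \<otimes>\<^bsub>pairing_group C\<^esub> state_elem C s)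
         [^]\<^bsub>pairing_group C\<^esub> k = \<one>\<^bsub>pairing_group C\<^esub>)"
proof -
  let ?A = "pairing_automaton C"
  interpret group "pairing_group C" by (rule group_pairing_group)
  have s: "s < dim_row C" and t: "t < dim_row C" and x: "x < dim_col C" and y: "y < dim_col C"
    using assms(4-7) by (simp_all add: pairing_automaton_def)
  note carrier = state_elem_in_carrier[OF s] state_elem_in_carrier[OF t]
    letter_elem_in_carrier[OF x] letter_elem_in_carrier[OF y]
  show ?thesis
  proof (intro conjI impI)
    let ?g = "letter_elem C x \<otimes>\<^bsub>pairing_group C\<^esub> inv\<^bsub>pairing_group C\<^esub> letter_elem C y"
    assume "arrow (star ?A) [s] (replicate k x) (replicate k y) [s]"
    then have "run ?A s (replicate k x) = s" "run_output ?A s (replicate k x) = replicate k y"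
      by (simp_all add: arrow_def)
    with state_elem_run_replicate[OF assms(2) x y s this(2)]
    have "state_elem C s \<otimes>\<^bsub>pairing_group C\<^esub> ?g [^]\<^bsub>pairing_group C\<^esub> k = state_elem C s"
      by simp
    then have "?g [^]\<^bsub>pairing_group C\<^esub> k = \<one>\<^bsub>pairing_group C\<^esub>"
      using carrier by simp
    \<comment> \<open>The run yields the inverse of the element in the claim; inverting preserves a
      trivial power.\<close>
    moreover have "letter_elem C y \<otimes>\<^bsub>pairing_group C\<^esub> inv\<^bsub>pairing_group C\<^esub> letter_elem C x =
        inv\<^bsub>pairing_group C\<^esub> ?g"
      using carrier by (simp add: inv_mult_group)
    ultimately show "(letter_elem C y \<otimes>\<^bsub>pairing_group C\<^esub> inv\<^bsub>pairing_group C\<^esub> letter_elem C x)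
        [^]\<^bsub>pairing_group C\<^esub> k = \<one>\<^bsub>pairing_group C\<^esub>"
      using carrier by (simp add: nat_pow_inv)
  next
    assume "arrow (star ?A) (replicate k s) [x] [x] (replicate k t)"
    then have "star_next ?A (replicate k s) [x] = replicate k t"
      "star_output ?A (replicate k s) [x] = [x]"
      by (simp_all add: arrow_def)
    \<comment> \<open>With \<open>z\<close> equal to \<open>x\<close>, the letter cancels on the
      right.\<close>
    from letter_elem_star_output_replicate[OF assms(2) s t x this]
    show "(inv\<^bsub>pairing_group C\<^esub> state_elem C t \<otimes>\<^bsub>pairing_group C\<^esub> state_elem C s)
        [^]\<^bsub>pairing_group C\<^esub> k = \<one>\<^bsub>pairing_group C\<^esub>"
      using carrier by simp
  qed
qed

end
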